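(* Let $F,G\subset \mathbb{Q}[X]$, let $\prec$ be a monomial ordering, and let $p$ be a prime number that is compatible with $F$ and permissible for $(G,\prec)$. Assume that $p$ satisfies $$(I_p(F):I_p(G))=\phi_p\bigl((I(F):I(G))\cap \mathbb{Z}_{(p)}[X]\bigr).$$ Let $K_{can}\subset \mathbb{Q}[X]$ be a finite subset. Then $K_{can}$ is a Gröbner basis of $(I(F):(I(F):I(G)))$ with respect to $\prec$ if the following conditions hold: 1. $p$ is permissible for $(K_{can},\prec)$; 2. $\phi_p(K_{can})$ is a Gröbner basis of $(I_p(F):(I_p(F):I_p(G)))$ with respect to $\prec$; 3. $K_{can}\subset (I(F):(I(F):I(G)))$.
   Context: $X=\{x_1,\ldots,x_n\}$ is a finite set of variables. For a prime number $p$, $\mathbb{Z}_{(p)}=\{a/b\in\mathbb{Q}\mid p\nmid b\}$ and $\phi_p:\mathbb{Z}_{(p)}[X]\to\mathbb{F}_p[X]$ is the canonical projection (reduction of coefficients modulo $p$). For $F\subset\mathbb{Q}[X]$, $I(F)$ is the ideal of $\mathbb{Q}[X]$ generated by $F$. For $F\subset \mathbb{Z}_{(p)}[X]$, $I_p(F)$ is the ideal of $\mathbb{F}_p[X]$ generated by $\phi_p(F)$, and $I_p^0(F)=\phi_p(I(F)\cap\mathbb{Z}_{(p)}[X])$. For ideals $A,B$ of a ring, $(A:B)=\{f\mid fB\subset A\}$. Let $\mathrm{lc}_\prec(f)$ denote the leading coefficient of $f$ with respect to $\prec$. A prime $p$ is *weak permissible* for $F\subset\mathbb{Q}[X]$ if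 $F\subset\mathbb{Z}_{(p)}[X]$; it is *permissible* for $(F,\prec)$ if it is weak permissible for $F$ and $\phi_p(\mathrm{lc}_\prec(f))\neq 0$ for all $f\in F$; it is *compatible* with $F$ if it is weak permissible for $F$ and $I_p^0(F)=I_p(F)$. *)

theory Defs
  imports
    "HOL-Library.Poly_Mapping"
    "Berlekamp_Zassenhaus.Finite_Field"
begin

type_synonym 'x monomial = "'x \<Rightarrow>\<^sub>0 nat"
type_synonym ('x, 'k) mpoly = "('x \<Rightarrow>\<^sub>0 nat) \<Rightarrow>\<^sub>0 'k"

text \<open>The commutative ring regarded as a module over itself: its submodules are its ideals.\<close>

definition ideal_gen :: "'r::comm_ring_1 set \<Rightarrow> 'r set" where
  "ideal_gen S = Modules.module.span (*) S"

lemma ideal_gen_explicit: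
  "ideal_gen S = {(\<Sum>a\<in>T. r a * a) | T r. finite T \<and> T \<subseteq> S}"
proof -
  interpret Modules.module "(*) :: 'a \<Rightarrow> 'a \<Rightarrow> 'a"
    by unfold_locales (simp_all add: algebra_simps)
  show ?thesis
    unfolding ideal_gen_def span_explicit by blast
qed

definition colon :: "'r::comm_ring_1 set \<Rightarrow> 'r set \<Rightarrow> 'r set" where
  "colon A B = {f. \<forall>b\<in>B. f * b \<in> A}"

text \<open>Monomial orderings are global, i.e. well-orderings; monomials are written additively as
  exponent vectors.\<close>

definition monomial_ordering :: "('x monomial \<Rightarrow> 'x monomial \<Rightarrow> bool) \<Rightarrow> bool" where
  "monomial_ordering prec \<longleftrightarrow>
     irreflp prec \<and> transp prec \<and> totalp prec \<and>
     (\<forall>s t u. prec s t \<longrightarrow> prec (s + u) (t + u)) \<and>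
     wfp prec"

definition lead_monomial ::
    "('x monomial \<Rightarrow> 'x monomial \<Rightarrow> bool) \<Rightarrow> ('x, 'k::zero) mpoly \<Rightarrow> 'x monomial" where
  "lead_monomial prec f =
     (THE m. m \<in> Poly_Mapping.keys f \<and> (\<forall>t\<in>Poly_Mapping.keys f. t \<noteq> m \<longrightarrow> prec t m))"

text \<open>The leading monomial of \<open>0\<close> is unspecified, but its leading coefficient and its leading
  term are \<open>0\<close>.\<close>

definition leading_coeff ::
    "('x monomial \<Rightarrow> 'x monomial \<Rightarrow> bool) \<Rightarrow> ('x, 'k::zero) mpoly \<Rightarrow> 'k" where
  "leading_coeff prec f = Poly_Mapping.lookup f (lead_monomial prec f)"

definition lead_term ::
    "('x monomial \<Rightarrow> 'x monomial \<Rightarrow> bool) \<Rightarrow> ('x, 'k::zero) mpoly \<Rightarrow> ('x, 'k) mpoly" where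
  "lead_term prec f = Poly_Mapping.single (lead_monomial prec f) (leading_coeff prec f)"

definition groebner_basis ::
    "('x monomial \<Rightarrow> 'x monomial \<Rightarrow> bool) \<Rightarrow> ('x, 'k::field) mpoly set \<Rightarrow> ('x, 'k) mpoly set \<Rightarrow> bool"
  where
  "groebner_basis prec B I \<longleftrightarrow>
     finite B \<and> B \<subseteq> I \<and> ideal_gen (lead_term prec ` B) = ideal_gen (lead_term prec ` I)"

text \<open>The prime \<open>p\<close> is the cardinality of a type \<open>'p\<close> of class \<open>prime_card\<close>, and the field with
  \<open>p\<close> elements is \<open>'p mod_ring\<close>.\<close>

definition localization :: "nat \<Rightarrow> rat set" where
  "localization p = {of_int a / of_int b | a b. \<not> int p dvd b}"

definition loc_polys :: "nat \<Rightarrow> ('x, rat) mpoly set" where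
  "loc_polys p = {f. \<forall>m. Poly_Mapping.lookup f m \<in> localization p}"

text \<open>Only meaningful on \<open>localization CARD('p)\<close>, where the reduced denominator is a unit
  modulo \<open>p\<close>.\<close>

definition residue_rat :: "rat \<Rightarrow> 'p::prime_card mod_ring" where
  "residue_rat c = of_int (fst (quotient_of c)) / of_int (snd (quotient_of c))"

lemma of_int_mod_ring_eq_0_iff:
  "(of_int b :: 'p::prime_card mod_ring) = 0 \<longleftrightarrow> int CARD('p) dvd b"
  unfolding of_int_of_int_mod_ring by transfer (simp add: dvd_eq_mod_eq_0)

lemma residue_rat_fraction:
  assumes "\<not> int CARD('p) dvd b"
  shows "residue_rat (of_int a / of_int b) = (of_int a / of_int b :: 'p::prime_card mod_ring)"
proof -
  obtain c d where cd: "quotient_of (of_int a / of_int b) = (c, d)"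
    by (cases "quotient_of (of_int a / of_int b)")
  have "b \<noteq> 0" "d > 0"
    using assms quotient_of_denom_pos[OF cd] by auto
  have "(of_int a / of_int b :: rat) = of_int c / of_int d"
    using quotient_of_div[OF cd] .
  then have "(of_int (a * d) :: rat) = of_int (c * b)"
    using \<open>b \<noteq> 0\<close> \<open>d > 0\<close> by (simp add: field_simps)
  then have eq: "a * d = c * b"
    by (simp only: of_int_eq_iff)
  have "coprime c d"
    using quotient_of_coprime[OF cd] .
  moreover have "d dvd c * b"
    by (metis eq dvd_triv_right)
  ultimately have "d dvd b"
    by (simp add: coprime_commute coprime_dvd_mult_right_iff)
  then have "\<not> int CARD('p) dvd d"
    using assms dvd_trans by blast
  then have nz: "(of_int d :: 'p mod_ring) \<noteq> 0" "(of_int b :: 'p mod_ring) \<noteq> 0"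
    using assms by (simp_all add: of_int_mod_ring_eq_0_iff)
  have "(of_int a * of_int d :: 'p mod_ring) = of_int c * of_int b"
    unfolding of_int_mult[symmetric] eq ..
  then show ?thesis
    using nz by (simp add: residue_rat_def cd frac_eq_eq)
qed

definition reduce_poly :: "('x, rat) mpoly \<Rightarrow> ('x, 'p::prime_card mod_ring) mpoly" where
  "reduce_poly f = Poly_Mapping.map residue_rat f"

lemma lookup_reduce_poly:
  "Poly_Mapping.lookup (reduce_poly f) m = residue_rat (Poly_Mapping.lookup f m)"
  by (simp add: reduce_poly_def Poly_Mapping.map.rep_eq when_def residue_rat_def)

definition reduced_ideal :: "('x, rat) mpoly set \<Rightarrow> ('x, 'p::prime_card mod_ring) mpoly set" where
  "reduced_ideal F = ideal_gen (reduce_poly ` F)"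

definition reduced_ideal0 :: "('x, rat) mpoly set \<Rightarrow> ('x, 'p::prime_card mod_ring) mpoly set" where
  "reduced_ideal0 F = reduce_poly ` (ideal_gen F \<inter> loc_polys CARD('p))"

definition weak_permissible :: "'p::prime_card itself \<Rightarrow> ('x, rat) mpoly set \<Rightarrow> bool" where
  "weak_permissible TYPE('p) F \<longleftrightarrow> F \<subseteq> loc_polys CARD('p)"

definition permissible ::
    "'p::prime_card itself \<Rightarrow> ('x monomial \<Rightarrow> 'x monomial \<Rightarrow> bool) \<Rightarrow> ('x, rat) mpoly set \<Rightarrow> bool"
  where
  "permissible TYPE('p) prec F \<longleftrightarrow>
     weak_permissible TYPE('p) F \<and>
     (\<forall>f\<in>F. (residue_rat (leading_coeff prec f) :: 'p mod_ring) \<noteq> 0)"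

definition compatible :: "'p::prime_card itself \<Rightarrow> ('x, rat) mpoly set \<Rightarrow> bool" where
  "compatible TYPE('p) F \<longleftrightarrow>
     weak_permissible TYPE('p) F \<and>
     (reduced_ideal0 F :: ('x, 'p mod_ring) mpoly set) = reduced_ideal F"

end

theory Submission imports Defs begin

text \<open>Write \<open>H = (I(F) : (I(F) : I(G)))\<close>. Compatibility and the assumption on \<open>(I(F) : I(G))\<close> show that
  \<open>\<phi>\<^sub>p\<close> maps \<open>H \<inter> \<int>\<^sub>(\<^sub>p\<^sub>)[X]\<close> into \<open>(I\<^sub>p(F) : (I\<^sub>p(F) : I\<^sub>p(G)))\<close>. Suppose the leading monomial of some \<open>h \<in> H\<close>
  is not divisible by that of any element of \<open>K\<^sub>c\<^sub>a\<^sub>n\<close>. Fully reducing the tail of \<open>h\<close> modulo \<open>K\<^sub>c\<^sub>a\<^sub>n\<close> over \<open>\<rat>\<close>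
  yields a nonzero \<open>r \<in> H\<close> no monomial of which is divisible by a leading monomial of \<open>K\<^sub>c\<^sub>a\<^sub>n\<close>. After
  scaling, \<open>r\<close> has coefficients in \<open>\<int>\<^sub>(\<^sub>p\<^sub>)\<close> and nonzero reduction. The leading monomial of \<open>\<phi>\<^sub>p(r)\<close>, possibly
  smaller than that of \<open>r\<close> but still one of its monomials, is divisible by a leading monomial of \<open>\<phi>\<^sub>p(K\<^sub>c\<^sub>a\<^sub>n)\<close>,
  and these agree with those of \<open>K\<^sub>c\<^sub>a\<^sub>n\<close>: a contradiction.\<close>

section \<open>Ideals as submodules of the ring; coefficients of products\<close>

global_interpretation ideal: Modules.module "(*) :: 'r::comm_ring_1 \<Rightarrow> 'r \<Rightarrow> 'r"
  rewrites "Modules.module.span ((*) :: 'r \<Rightarrow> 'r \<Rightarrow> 'r) = ideal_gen"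
proof -
  show "Modules.module ((*) :: 'r \<Rightarrow> 'r \<Rightarrow> 'r)"
    by unfold_locales (simp_all add: algebra_simps)
  show "Modules.module.span ((*) :: 'r \<Rightarrow> 'r \<Rightarrow> 'r) = ideal_gen"
    by (simp add: ideal_gen_def fun_eq_iff)
qed

text \<open>As a rule about multiplication this would reverse associativity.\<close>

declare ideal.scale_scale [simp del]

lemma subspace_colon:
  assumes "ideal.subspace A"
  shows "ideal.subspace (colon A B)"
  using assms by (auto simp: ideal.subspace_def colon_def distrib_right mult.assoc)

text \<open>The product is a convolution over all pairs of monomials, and only pairs from the two
  supports contribute. Leaving the supersets \<open>A\<close> and \<open>B\<close> free allows a
  product and its reduction modulo p to be expanded over the same index set.\<close>

lemma lookup_mult_sum:
  fixes f g :: "('x, 'k::comm_semiring_0) mpoly"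
  assumes "finite A" "Poly_Mapping.keys f \<subseteq> A" "finite B" "Poly_Mapping.keys g \<subseteq> B"
  shows "Poly_Mapping.lookup (f * g) m = (\<Sum>(a, b)\<in>A \<times> B.
      Poly_Mapping.lookup f a * Poly_Mapping.lookup g b when m = a + b)"
proof -
  have "Poly_Mapping.lookup (f * g) m = (\<Sum>(a, b).
      Poly_Mapping.lookup f a * Poly_Mapping.lookup g b when m = a + b)"
    by (simp add: times_poly_mapping.rep_eq prod_fun_unfold_prod)
  also have "\<dots> = (\<Sum>(a, b)\<in>A \<times> B.
      Poly_Mapping.lookup f a * Poly_Mapping.lookup g b when m = a + b)"
  proof (rule Sum_any.expand_superset)
    show "{ab. (case ab of (a, b) \<Rightarrow> Poly_Mapping.lookup f a * Poly_Mapping.lookup g b when m = a + b) \<noteq> 0} \<subseteq> A \<times> B"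
      using assms(2,4) by (force simp: when_def in_keys_iff split: if_splits
          del: lookup_eq_zero_in_keys_contradict)
  qed (use assms in simp)
  finally show ?thesis .
qed

lemma lookup_single_mult:
  fixes f :: "('x, 'k::comm_semiring_0) mpoly"
  shows "Poly_Mapping.lookup (Poly_Mapping.single s c * f) (s + m) = c * Poly_Mapping.lookup f m"
proof -
  \<comment> \<open>Inserting \<open>m\<close> keeps the one surviving summand in the index set even
    when \<open>m\<close> is not a monomial of \<open>f\<close>.\<close>
  have "Poly_Mapping.lookup (Poly_Mapping.single s c * f) (s + m) =
      (\<Sum>(a, b)\<in>{s} \<times> insert m (Poly_Mapping.keys f).
        Poly_Mapping.lookup (Poly_Mapping.single s c) a * Poly_Mapping.lookup f b when s + m = a + b)"
    by (rule lookup_mult_sum) auto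
  also have "\<dots> = (\<Sum>b\<in>insert m (Poly_Mapping.keys f). c * Poly_Mapping.lookup f b when m = b)"
    by (subst sum.cartesian_product[symmetric]) simp
  also have "\<dots> = c * Poly_Mapping.lookup f m"
    by (simp add: when_def sum.delta')
  finally show ?thesis .
qed

lemma lookup_single_zero_mult:
  "Poly_Mapping.lookup (Poly_Mapping.single 0 c * f) m = c * Poly_Mapping.lookup (f :: ('x, 'k::comm_semiring_0) mpoly) m"
  using lookup_single_mult[of 0 c f m] by simp

lemma keys_single_mult:
  fixes f :: "('x, 'k::comm_semiring_0) mpoly"
  assumes "t \<in> Poly_Mapping.keys (Poly_Mapping.single s c * f)"
  obtains m where "m \<in> Poly_Mapping.keys f" "t = s + m"
  using keys_mult[of "Poly_Mapping.single s c" f] assms by (auto split: if_splits)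

subsection \<open>Leading monomials\<close>

text \<open>A finite nonempty support has a maximum for a total order, found by induction on the
  set; asymmetry makes it unique, so the description in \<open>lead_monomial\<close> denotes
  it.\<close>

lemma lead_monomial:
  assumes "monomial_ordering prec" and "f \<noteq> 0"
  shows lead_monomial_in_keys: "lead_monomial prec f \<in> Poly_Mapping.keys f"
    and lead_monomial_max: "t \<in> Poly_Mapping.keys f \<Longrightarrow> t \<noteq> lead_monomial prec f
      \<Longrightarrow> prec t (lead_monomial prec f)"
proof -
  have irr: "\<And>a. \<not> prec a a" and tr: "\<And>a b c. prec a b \<Longrightarrow> prec b c \<Longrightarrow> prec a c"
    and tot: "\<And>a b. a \<noteq> b \<Longrightarrow> prec a b \<or> prec b a"
    using assms(1) unfolding monomial_ordering_def
    by (blast dest: irreflpD transpD totalpD)+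
  have "\<exists>m\<in>A. \<forall>t\<in>A. t \<noteq> m \<longrightarrow> prec t m" if "finite A" "A \<noteq> {}" for A
    using that
  proof (induction A rule: finite_ne_induct)
    case (insert a A)
    then obtain m where m: "m \<in> A" "\<forall>t\<in>A. t \<noteq> m \<longrightarrow> prec t m" by blast
    show ?case
    proof (cases "prec a m")
      case True
      then show ?thesis using m by auto
    next
      case False
      then have "prec m a" using tot[of a m] m insert.hyps by blast
      then have "\<forall>t\<in>A. prec t a" using m tr by metis
      then show ?thesis by auto
    qed
  qed simp
  from this[of "Poly_Mapping.keys f"] obtain m
    where m: "m \<in> Poly_Mapping.keys f" "\<forall>t\<in>Poly_Mapping.keys f. t \<noteq> m \<longrightarrow> prec t m"
    using assms(2) by auto
  have asym: "\<not> (prec a b \<and> prec b a)" for a b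
    using irr tr by blast
  have "lead_monomial prec f = m"
    unfolding lead_monomial_def
  proof (rule the_equality)
    fix m'
    assume "m' \<in> Poly_Mapping.keys f \<and> (\<forall>t\<in>Poly_Mapping.keys f. t \<noteq> m' \<longrightarrow> prec t m')"
    then show "m' = m" using m asym[of m m'] by auto
  qed (use m in blast)
  then show "lead_monomial prec f \<in> Poly_Mapping.keys f"
    and "t \<in> Poly_Mapping.keys f \<Longrightarrow> t \<noteq> lead_monomial prec f
      \<Longrightarrow> prec t (lead_monomial prec f)"
    using m by auto
qed

lemma lead_monomial_eqI:
  assumes "monomial_ordering prec" and "m \<in> Poly_Mapping.keys f"
    and "\<And>t. t \<in> Poly_Mapping.keys f \<Longrightarrow> t \<noteq> m \<Longrightarrow> prec t m"
  shows "lead_monomial prec f = m"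
proof (rule ccontr)
  assume ne: "lead_monomial prec f \<noteq> m"
  have "f \<noteq> 0" using assms(2) by auto
  note lm = lead_monomial[OF assms(1) this]
  have "prec m (lead_monomial prec f)" "prec (lead_monomial prec f) m"
    using lm assms(2,3) ne by auto
  then show False
    using assms(1) unfolding monomial_ordering_def by (meson irreflpD transpD)
qed

lemma leading_coeff_eq_0_iff:
  assumes "monomial_ordering prec"
  shows "leading_coeff prec f = 0 \<longleftrightarrow> f = 0"
  using lead_monomial_in_keys[OF assms, of f]
  by (auto simp: leading_coeff_def in_keys_iff del: lookup_eq_zero_in_keys_contradict)

lemma lead_term_eq_0_iff:
  assumes "monomial_ordering prec"
  shows "lead_term prec f = 0 \<longleftrightarrow> f = 0"
proof -
  have "Poly_Mapping.lookup (lead_term prec f) (lead_monomial prec f) = leading_coeff prec f"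
    by (simp add: lead_term_def)
  then have "leading_coeff prec f = 0" if "lead_term prec f = 0"
    using that by simp
  moreover have "lead_term prec f = 0" if "leading_coeff prec f = 0"
    using that by (simp add: lead_term_def)
  ultimately show ?thesis
    using leading_coeff_eq_0_iff[OF assms, of f] by blast
qed

section \<open>Divisibility by leading monomials and full reduction\<close>

text \<open>Zero elements of \<open>K\<close> are excluded because their leading monomial is an
  arbitrary value.\<close>

definition lead_divides ::
    "('x monomial \<Rightarrow> 'x monomial \<Rightarrow> bool) \<Rightarrow> ('x, 'k::zero) mpoly set \<Rightarrow> 'x monomial \<Rightarrow> bool" where
  "lead_divides prec K t \<longleftrightarrow> (\<exists>k\<in>K. k \<noteq> 0 \<and> (\<exists>s. t = s + lead_monomial prec k))"

text \<open>Membership in a monomial ideal is decided monomial by monomial: each multiple of a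
  generator contains only multiples of that generator's monomial, and addition creates no new
  monomials.\<close>

lemma lead_divides_if_in_lead_term_ideal:
  fixes f :: "('x, 'k::comm_ring_1) mpoly"
  assumes "monomial_ordering prec" and "f \<in> ideal_gen (lead_term prec ` K)" and "t \<in> Poly_Mapping.keys f"
  shows "lead_divides prec K t"
proof -
  have "\<forall>t\<in>Poly_Mapping.keys f. lead_divides prec K t"
    using assms(2)
  proof (induction f rule: ideal.span_induct_alt)
    case (step c x y)
    then obtain k where k: "k \<in> K" "x = lead_term prec k" by blast
    have "lead_divides prec K t" if t: "t \<in> Poly_Mapping.keys (c * x)" for t
    proof -
      obtain a b where ab: "t = a + b" "b \<in> Poly_Mapping.keys x"
        using keys_mult[of c x] t by blast
      \<comment> \<open>The term \<open>x\<close> has a monomial, so it is not the zero lead term of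
        0.\<close>
      then have "k \<noteq> 0" using k(2) lead_term_eq_0_iff[OF assms(1), of k] by auto
      moreover have "b = lead_monomial prec k"
        using ab(2) unfolding k(2) lead_term_def by (auto split: if_splits)
      ultimately show ?thesis
        unfolding lead_divides_def using ab(1) k(1) by blast
    qed
    then show ?case
      using step.IH keys_add[of "c * x" y] by blast
  qed simp
  then show ?thesis using assms(3) by blast
qed

text \<open>Over a field the quotient of the leading coefficients turns divisibility of monomials
  into divisibility of terms.\<close>

lemma lead_term_in_ideal_if_lead_divides:
  fixes h :: "('x, 'k::field) mpoly"
  assumes "monomial_ordering prec" and "lead_divides prec K (lead_monomial prec h)"
  shows "lead_term prec h \<in> ideal_gen (lead_term prec ` K)"
proof -
  obtain k s where k: "k \<in> K" "k \<noteq> 0" "lead_monomial prec h = s + lead_monomial prec k"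
    using assms(2) unfolding lead_divides_def by blast
  then have "leading_coeff prec k \<noteq> 0"
    using leading_coeff_eq_0_iff[OF assms(1)] by blast
  then have "lead_term prec h =
      Poly_Mapping.single s (leading_coeff prec h / leading_coeff prec k) * lead_term prec k"
    by (simp add: lead_term_def mult_single k(3))
  then show ?thesis
    using k(1) by (auto intro: ideal.span_scale ideal.span_base)
qed

text \<open>Well-founded induction on a strict upper bound \<open>m\<close> of the monomials. The
  top monomial \<open>l\<close> is either cancelled by a multiple of some \<open>k\<close> or set
  aside as irreducible; what is left lies below \<open>l\<close>, which becomes the new
  bound.\<close>

lemma full_reduction:
  fixes f :: "('x, 'k::field) mpoly"
  assumes mo: "monomial_ordering prec" and "\<forall>t\<in>Poly_Mapping.keys f. prec t m"
  shows "\<exists>q\<in>ideal_gen K. \<forall>t\<in>Poly_Mapping.keys (f - q). prec t m \<and> \<not> lead_divides prec K t"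
proof -
  have "wfp prec" using mo by (simp add: monomial_ordering_def)
  then show ?thesis using assms(2)
  proof (induction m arbitrary: f rule: wfp_induct_rule)
    case (less m f)
    have tr: "\<And>a b c. prec a b \<Longrightarrow> prec b c \<Longrightarrow> prec a c"
      and add: "\<And>s t u. prec s t \<Longrightarrow> prec (u + s) (u + t)"
      using mo unfolding monomial_ordering_def by (blast dest: transpD, metis add.commute)
    show ?case
    proof (cases "f = 0")
      case True
      then show ?thesis by (auto intro!: bexI[of _ 0] ideal.span_zero)
    next
      case False
      define l where "l = lead_monomial prec f"
      have l: "l \<in> Poly_Mapping.keys f" "\<And>t. t \<in> Poly_Mapping.keys f \<Longrightarrow> t \<noteq> l \<Longrightarrow> prec t l"
        unfolding l_def using lead_monomial[OF mo False] by auto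
      have lm: "prec l m" using l(1) less.prems by blast
      show ?thesis
      proof (cases "lead_divides prec K l")
        case True
        then obtain k s where k: "k \<in> K" "k \<noteq> 0" "l = s + lead_monomial prec k"
          unfolding lead_divides_def by blast
        \<comment> \<open>The multiple of \<open>k\<close> that agrees with \<open>f\<close> at
          \<open>l\<close>; its other monomials stay below \<open>l\<close> because the ordering
          respects addition of \<open>s\<close>.\<close>
        define g where "g = Poly_Mapping.single s (Poly_Mapping.lookup f l / leading_coeff prec k) * k"
        have g: "g \<in> ideal_gen K"
          unfolding g_def using k(1) by (intro ideal.span_scale ideal.span_base)
        have "leading_coeff prec k \<noteq> 0"
          using k(2) leading_coeff_eq_0_iff[OF mo] by blast
        then have "Poly_Mapping.lookup g l = Poly_Mapping.lookup f l"
          unfolding g_def k(3) lookup_single_mult by (simp add: leading_coeff_def)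
        then have "l \<notin> Poly_Mapping.keys (f - g)" by (simp add: in_keys_iff lookup_minus)
        moreover have "prec t l" if "t \<in> Poly_Mapping.keys g" "t \<noteq> l" for t
          using that k(3) lead_monomial_max[OF mo k(2)] add
          unfolding g_def by (auto elim!: keys_single_mult)
        moreover have "Poly_Mapping.keys (f - g) \<subseteq> Poly_Mapping.keys f \<union> Poly_Mapping.keys g"
          by (rule keys_diff)
        ultimately have "\<forall>t\<in>Poly_Mapping.keys (f - g). prec t l" using l(2) by blast
        from less.IH[OF lm this] obtain q where q: "q \<in> ideal_gen K"
          "\<forall>t\<in>Poly_Mapping.keys (f - g - q). prec t l \<and> \<not> lead_divides prec K t" by blast
        show ?thesis
        proof (rule bexI[of _ "g + q"])
          show "\<forall>t\<in>Poly_Mapping.keys (f - (g + q)). prec t m \<and> \<not> lead_divides prec K t"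
            using q(2) tr lm by (metis diff_diff_eq)
        qed (use g q ideal.span_add in blast)
      next
        case False
        define g where "g = Poly_Mapping.single l (Poly_Mapping.lookup f l)"
        have "l \<notin> Poly_Mapping.keys (f - g)" by (simp add: in_keys_iff lookup_minus g_def)
        moreover have "Poly_Mapping.keys g \<subseteq> {l}" by (simp add: g_def)
        moreover have "Poly_Mapping.keys (f - g) \<subseteq> Poly_Mapping.keys f \<union> Poly_Mapping.keys g"
          by (rule keys_diff)
        ultimately have "\<forall>t\<in>Poly_Mapping.keys (f - g). prec t l" using l(2) by blast
        from less.IH[OF lm this] obtain q where q: "q \<in> ideal_gen K"
          "\<forall>t\<in>Poly_Mapping.keys (f - g - q). prec t l \<and> \<not> lead_divides prec K t" by blast
        \<comment> \<open>The \<open>q\<close> that reduces the tail also serves \<open>f\<close>: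
          adding \<open>g\<close> back restores at most the irreducible monomial
          \<open>l\<close>.\<close>
        have "Poly_Mapping.keys (f - q) \<subseteq> insert l (Poly_Mapping.keys (f - g - q))"
          using keys_add[of "f - g - q" g] \<open>Poly_Mapping.keys g \<subseteq> {l}\<close> by auto
        then show ?thesis
          using q lm tr False by (intro bexI[of _ q]) blast+
      qed
    qed
  qed
qed

text \<open>Keeping the leading term of \<open>h\<close> and reducing its tail makes the result nonzero.\<close>

lemma ex_nonzero_reduced:
  fixes h :: "('x, 'k::field) mpoly"
  assumes mo: "monomial_ordering prec" and "ideal.subspace H" "K \<subseteq> H"
    and h: "h \<in> H" "h \<noteq> 0" "\<not> lead_divides prec K (lead_monomial prec h)"
  obtains r where "r \<in> H" "r \<noteq> 0" "\<forall>t\<in>Poly_Mapping.keys r. \<not> lead_divides prec K t"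
proof -
  define l where "l = lead_monomial prec h"
  define g where "g = Poly_Mapping.single l (Poly_Mapping.lookup h l)"
  have irr: "\<not> prec l l" using mo unfolding monomial_ordering_def by (blast dest: irreflpD)
  have "l \<notin> Poly_Mapping.keys (h - g)" by (simp add: in_keys_iff lookup_minus g_def)
  moreover have keys_g: "Poly_Mapping.keys g \<subseteq> {l}" by (simp add: g_def)
  moreover have "Poly_Mapping.keys (h - g) \<subseteq> Poly_Mapping.keys h \<union> Poly_Mapping.keys g"
    by (rule keys_diff)
  ultimately have "\<forall>t\<in>Poly_Mapping.keys (h - g). prec t l"
    unfolding l_def using lead_monomial_max[OF mo h(2)] by blast
  from full_reduction[OF mo this, of K] obtain q where q: "q \<in> ideal_gen K"
    "\<forall>t\<in>Poly_Mapping.keys (h - g - q). prec t l \<and> \<not> lead_divides prec K t" by blast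
  have "q \<in> H" using q(1) assms(2,3) ideal.span_minimal by blast
  then have "h - q \<in> H" using h(1) assms(2) ideal.subspace_diff by blast
  \<comment> \<open>The remainder lies strictly below \<open>l\<close>, so subtracting
    \<open>q\<close> cannot have touched the coefficient of \<open>h\<close> at
    \<open>l\<close>.\<close>
  moreover have "l \<notin> Poly_Mapping.keys (h - g - q)" using q(2) irr by blast
  then have "Poly_Mapping.lookup (h - q) l = Poly_Mapping.lookup h l"
    by (simp add: in_keys_iff lookup_minus g_def)
  then have "h - q \<noteq> 0"
    using lead_monomial_in_keys[OF mo h(2)]
    by (auto simp: l_def in_keys_iff del: lookup_eq_zero_in_keys_contradict)
  moreover have "Poly_Mapping.keys (h - q) \<subseteq> insert l (Poly_Mapping.keys (h - g - q))"
    using keys_add[of "h - g - q" g] keys_g by auto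
  then have "\<forall>t\<in>Poly_Mapping.keys (h - q). \<not> lead_divides prec K t"
    using q(2) h(3) by (auto simp: l_def)
  ultimately show thesis using that by blast
qed

subsection \<open>Reduction modulo \<open>p\<close>\<close>

lemma localization_closed:
  assumes "prime p" "x \<in> localization p" "y \<in> localization p"
  shows localization_add: "x + y \<in> localization p"
    and localization_mult: "x * y \<in> localization p"
proof -
  obtain a b c d where ab: "x = of_int a / of_int b" "\<not> int p dvd b"
    and cd: "y = of_int c / of_int d" "\<not> int p dvd d"
    using assms(2,3) unfolding localization_def by blast
  have nz: "b \<noteq> 0" "d \<noteq> 0" using ab cd by auto
  have "\<not> int p dvd b * d"
    using assms(1) ab(2) cd(2) prime_dvd_mult_iff[of "int p"] by simp
  moreover have "x + y = of_int (a * d + c * b) / of_int (b * d)"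
    and "x * y = of_int (a * c) / of_int (b * d)"
    using nz by (simp_all add: ab(1) cd(1) field_simps)
  ultimately show "x + y \<in> localization p" "x * y \<in> localization p"
    unfolding localization_def by blast+
qed

lemma localization_of_int:
  assumes "prime p"
  shows "of_int a \<in> localization p"
proof -
  have "(of_int a :: rat) = of_int a / of_int 1" by simp
  moreover have "\<not> int p dvd 1" using prime_gt_1_nat[OF assms] by simp
  ultimately show ?thesis unfolding localization_def by blast
qed

lemma localization_0: "prime p \<Longrightarrow> 0 \<in> localization p"
  using localization_of_int[of p 0] by simp

lemma localization_1: "prime p \<Longrightarrow> 1 \<in> localization p"
  using localization_of_int[of p 1] by simp

lemma localization_sum:
  assumes "prime p" "\<And>i. i \<in> A \<Longrightarrow> f i \<in> localization p"
  shows "sum f A \<in> localization p"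
  using assms(2)
  by (induction A rule: infinite_finite_induct)
    (simp_all add: localization_0 localization_add assms(1))

text \<open>The localization is a valuation ring: in lowest terms p cannot divide both numerator and
  denominator. For 0 the first alternative holds.\<close>

lemma localization_total:
  assumes "prime p"
  shows "x \<in> localization p \<or> inverse x \<in> localization p"
proof -
  obtain a b where ab: "quotient_of x = (a, b)" by fastforce
  have "\<not> (int p dvd a \<and> int p dvd b)"
    using quotient_of_coprime[OF ab] assms
    by (metis coprime_common_divisor not_prime_unit prime_int_nat_transfer prime_nat_int_transfer)
  moreover have "x = of_int a / of_int b" "inverse x = of_int b / of_int a"
    using quotient_of_div[OF ab] by simp_all
  ultimately show ?thesis unfolding localization_def by blast
qed

text \<open>Divisibility in a valuation ring is total, so a finite set of nonzero elements has one
  dividing all the others, namely one of least p-adic valuation.\<close>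

lemma ex_dividing_localization:
  fixes A :: "rat set"
  assumes "prime p" "finite A" "A \<noteq> {}" "0 \<notin> A"
  shows "\<exists>a\<in>A. \<forall>b\<in>A. inverse a * b \<in> localization p"
  using assms(2-)
proof (induction A rule: finite_ne_induct)
  case (singleton a)
  then show ?case using localization_1[OF assms(1)] by auto
next
  case (insert x A)
  then obtain a where a: "a \<in> A" "\<forall>b\<in>A. inverse a * b \<in> localization p" by auto
  have nz: "a \<noteq> 0" "x \<noteq> 0" using insert a by auto
  consider "inverse a * x \<in> localization p" | "inverse x * a \<in> localization p"
    using localization_total[OF assms(1), of "inverse a * x"] nz by (auto simp: mult.commute)
  then show ?case
  proof cases
    case 1
    then show ?thesis using a by blast
  next
    case 2
    \<comment> \<open>Transitivity of divisibility: x divides a and a divides b.\<close>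
    have "inverse x * b \<in> localization p" if "b \<in> A" for b
      using localization_mult[OF assms(1) 2 a(2)[rule_format, OF that]] nz by (simp add: field_simps)
    then show ?thesis using localization_1[OF assms(1)] nz by auto
  qed
qed

section \<open>The residue map and reduction of polynomials\<close>

text \<open>By \<open>residue_rat_fraction\<close> the residue may be computed from any fraction
  with denominator prime to p, so the common denominator \<open>b * d\<close> need not be cancelled
  and the claim becomes arithmetic of fractions in the residue field.\<close>

lemma residue_rat_closed:
  assumes "x \<in> localization CARD('p)" "y \<in> localization CARD('p)"
  shows residue_rat_add: "(residue_rat (x + y) :: 'p::prime_card mod_ring) = residue_rat x + residue_rat y"
    and residue_rat_mult: "(residue_rat (x * y) :: 'p mod_ring) = residue_rat x * residue_rat y"
proof -
  obtain a b c d where ab: "x = of_int a / of_int b" "\<not> int CARD('p) dvd b"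
    and cd: "y = of_int c / of_int d" "\<not> int CARD('p) dvd d"
    using assms unfolding localization_def by blast
  have nz: "b \<noteq> 0" "d \<noteq> 0" using ab cd by auto
  have nz': "(of_int b :: 'p mod_ring) \<noteq> 0" "(of_int d :: 'p mod_ring) \<noteq> 0"
    using ab cd by (simp_all add: of_int_mod_ring_eq_0_iff)
  have nd: "\<not> int CARD('p) dvd b * d"
    using prime_card[where 'a = 'p] ab(2) cd(2) prime_dvd_mult_iff[of "int CARD('p)"] by simp
  have eq: "x + y = of_int (a * d + c * b) / of_int (b * d)"
    "x * y = of_int (a * c) / of_int (b * d)"
    using nz by (simp_all add: ab(1) cd(1) field_simps)
  show "(residue_rat (x + y) :: 'p mod_ring) = residue_rat x + residue_rat y"
    "(residue_rat (x * y) :: 'p mod_ring) = residue_rat x * residue_rat y"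
    unfolding eq residue_rat_fraction[OF nd]
    unfolding ab cd residue_rat_fraction[OF ab(2)] residue_rat_fraction[OF cd(2)]
    by (simp_all only: of_int_add of_int_mult add_frac_eq[OF nz'] times_divide_times_eq)
qed

lemma residue_rat_0: "(residue_rat 0 :: 'p::prime_card mod_ring) = 0"
  and residue_rat_1: "(residue_rat 1 :: 'p::prime_card mod_ring) = 1"
  by (simp_all add: residue_rat_def)

lemma residue_rat_sum:
  assumes "\<And>i. i \<in> A \<Longrightarrow> f i \<in> localization CARD('p)"
  shows "(residue_rat (sum f A) :: 'p::prime_card mod_ring) = (\<Sum>i\<in>A. residue_rat (f i))"
  using assms
  by (induction A rule: infinite_finite_induct)
    (simp_all add: residue_rat_0 residue_rat_add localization_sum[OF prime_card[where 'a = 'p]])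

lemma keys_reduce_poly:
  "Poly_Mapping.keys (reduce_poly f :: ('x, 'p::prime_card mod_ring) mpoly)
    \<subseteq> Poly_Mapping.keys f"
proof
  fix t
  assume "t \<in> Poly_Mapping.keys (reduce_poly f :: ('x, 'p mod_ring) mpoly)"
  then have "(residue_rat (Poly_Mapping.lookup f t) :: 'p mod_ring) \<noteq> 0"
    by (simp add: in_keys_iff lookup_reduce_poly)
  then show "t \<in> Poly_Mapping.keys f"
    using residue_rat_0 by (metis in_keys_iff)
qed

lemma reduce_poly_mult:
  fixes f g :: "('x, rat) mpoly"
  assumes "f \<in> loc_polys CARD('p)" "g \<in> loc_polys CARD('p)"
  shows "(reduce_poly (f * g) :: ('x, 'p::prime_card mod_ring) mpoly) = reduce_poly f * reduce_poly g"
proof (rule poly_mapping_eqI)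
  fix m
  let ?\<phi> = "residue_rat :: rat \<Rightarrow> 'p mod_ring"
  have loc: "Poly_Mapping.lookup f a \<in> localization CARD('p)" "Poly_Mapping.lookup g b \<in> localization CARD('p)" for a b
    using assms by (auto simp: loc_polys_def)
  have "Poly_Mapping.lookup (reduce_poly (f * g)) m =
      ?\<phi> (\<Sum>(a, b)\<in>Poly_Mapping.keys f \<times> Poly_Mapping.keys g. Poly_Mapping.lookup f a * Poly_Mapping.lookup g b when m = a + b)"
    by (simp add: lookup_reduce_poly lookup_mult_sum[of "Poly_Mapping.keys f" f "Poly_Mapping.keys g" g])
  also have "\<dots> = (\<Sum>ab\<in>Poly_Mapping.keys f \<times> Poly_Mapping.keys g.
      ?\<phi> (case ab of (a, b) \<Rightarrow> Poly_Mapping.lookup f a * Poly_Mapping.lookup g b when m = a + b))"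
    by (rule residue_rat_sum)
      (simp add: case_prod_beta when_def localization_0 localization_mult prime_card loc)
  also have "\<dots> = (\<Sum>(a, b)\<in>Poly_Mapping.keys f \<times> Poly_Mapping.keys g.
      ?\<phi> (Poly_Mapping.lookup f a) * ?\<phi> (Poly_Mapping.lookup g b) when m = a + b)"
    by (rule sum.cong) (auto simp: when_def residue_rat_0 residue_rat_mult loc)
  also have "\<dots> = Poly_Mapping.lookup (reduce_poly f * reduce_poly g) m"
    \<comment> \<open>Reduction may shrink the supports, so the product of the reductions is
      expanded over the original ones.\<close>
    using keys_reduce_poly[of f, where 'p = 'p] keys_reduce_poly[of g, where 'p = 'p]
    by (simp add: lookup_mult_sum[of "Poly_Mapping.keys f" _ "Poly_Mapping.keys g"] lookup_reduce_poly)
  finally show "Poly_Mapping.lookup (reduce_poly (f * g)) m = Poly_Mapping.lookup 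
      (reduce_poly f * reduce_poly g :: ('x, 'p mod_ring) mpoly) m" .
qed

text \<open>Dividing by a coefficient of least p-adic valuation makes all coefficients p-integral
  and turns that coefficient into 1, which survives reduction.\<close>

lemma ex_scaled_reduction_nonzero:
  fixes r :: "('x, rat) mpoly"
  assumes "r \<noteq> 0"
  obtains c where "Poly_Mapping.single 0 c * r \<in> loc_polys CARD('p)"
    and "(reduce_poly (Poly_Mapping.single 0 c * r) :: ('x, 'p::prime_card mod_ring) mpoly) \<noteq> 0"
proof -
  let ?A = "Poly_Mapping.lookup r ` Poly_Mapping.keys r"
  have "?A \<noteq> {}" "0 \<notin> ?A" using assms by (auto simp: in_keys_iff del: lookup_eq_zero_in_keys_contradict)
  then obtain a where a: "a \<in> ?A" "\<forall>b\<in>?A. inverse a * b \<in> localization CARD('p)"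
    using ex_dividing_localization[OF prime_card[where 'a = 'p], of ?A] by auto
  let ?r = "Poly_Mapping.single 0 (inverse a) * r"
  have "Poly_Mapping.lookup ?r m \<in> localization CARD('p)" for m
    using a(2) localization_0[OF prime_card[where 'a = 'p]]
    by (cases "m \<in> Poly_Mapping.keys r") (auto simp: lookup_single_zero_mult in_keys_iff del: lookup_eq_zero_in_keys_contradict)
  then have "?r \<in> loc_polys CARD('p)" by (simp add: loc_polys_def)
  moreover obtain m where "Poly_Mapping.lookup r m = a" "a \<noteq> 0"
    using a(1) by (auto simp: in_keys_iff del: lookup_eq_zero_in_keys_contradict)
  then have "Poly_Mapping.lookup (reduce_poly ?r :: ('x, 'p mod_ring) mpoly) m = 1"
    by (simp add: lookup_reduce_poly lookup_single_zero_mult residue_rat_1)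
  then have "(reduce_poly ?r :: ('x, 'p mod_ring) mpoly) \<noteq> 0" by auto
  ultimately show thesis using that by blast
qed

text \<open>The leading coefficient survives reduction, and reduction introduces no monomial that
  could exceed the old maximum.\<close>

lemma lead_monomial_reduce_poly:
  fixes k :: "('x, rat) mpoly"
  assumes mo: "monomial_ordering prec"
    and "(residue_rat (leading_coeff prec k) :: 'p::prime_card mod_ring) \<noteq> 0"
  shows "lead_monomial prec (reduce_poly k :: ('x, 'p mod_ring) mpoly) = lead_monomial prec k"
proof (rule lead_monomial_eqI[OF mo])
  have "k \<noteq> 0" using assms(2) by (auto simp: leading_coeff_def residue_rat_0)
  then show "prec t (lead_monomial prec k)"
    if "t \<in> Poly_Mapping.keys (reduce_poly k :: ('x, 'p mod_ring) mpoly)" "t \<noteq> lead_monomial prec k" for t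
    using that keys_reduce_poly lead_monomial_max[OF mo] by blast
qed (use assms(2) in \<open>simp add: in_keys_iff lookup_reduce_poly leading_coeff_def\<close>)

section \<open>Transfer between the rationals and the residue field\<close>

text \<open>The second hypothesis lifts every element of the inner colon modulo p to a p-integral
  \<open>j\<close> in the rational one. The product \<open>h * j\<close> is then p-integral and lies
  in the ideal of \<open>F\<close>, so compatibility puts its reduction into
  \<open>reduced_ideal F\<close>.\<close>

lemma reduce_poly_mem_double_colon:
  fixes F G :: "('x, rat) mpoly set"
  assumes "compatible TYPE('p::prime_card) F"
    and "colon (reduced_ideal F) (reduced_ideal G) =
      (reduce_poly ` (colon (ideal_gen F) (ideal_gen G) \<inter> loc_polys CARD('p))
        :: ('x, 'p mod_ring) mpoly set)"
    and h: "h \<in> colon (ideal_gen F) (colon (ideal_gen F) (ideal_gen G))" "h \<in> loc_polys CARD('p)"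
  shows "(reduce_poly h :: ('x, 'p mod_ring) mpoly) \<in>
    colon (reduced_ideal F) (colon (reduced_ideal F) (reduced_ideal G))"
proof -
  have "reduce_poly h * reduce_poly j \<in> (reduced_ideal F :: ('x, 'p mod_ring) mpoly set)"
    if j: "j \<in> colon (ideal_gen F) (ideal_gen G)" "j \<in> loc_polys CARD('p)" for j
  proof -
    have "h * j \<in> ideal_gen F" using h(1) j(1) by (auto simp: colon_def)
    moreover have "h * j \<in> loc_polys CARD('p)"
    proof -
      have "Poly_Mapping.lookup (h * j) m \<in> localization CARD('p)" for m
        using h(2) j(2)
        by (auto simp: lookup_mult_sum[of "Poly_Mapping.keys h" h "Poly_Mapping.keys j" j] loc_polys_def when_def
            intro!: localization_sum localization_mult localization_0 prime_card)
      then show ?thesis by (simp add: loc_polys_def)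
    qed
    ultimately have "(reduce_poly (h * j) :: ('x, 'p mod_ring) mpoly) \<in> reduced_ideal0 F"
      by (auto simp: reduced_ideal0_def)
    then show ?thesis
      using assms(1) reduce_poly_mult[OF h(2) j(2)] by (simp add: compatible_def)
  qed
  then show ?thesis unfolding assms(2) by (auto simp: colon_def[of "reduced_ideal F"])
qed

theorem theorem2p2p8:
  fixes F G K\<^sub>c\<^sub>a\<^sub>n :: "('x::finite, rat) mpoly set"
    and prec :: "'x monomial \<Rightarrow> 'x monomial \<Rightarrow> bool"
  assumes "monomial_ordering prec"
    and "compatible TYPE('p::prime_card) F"
    and "permissible TYPE('p) prec G"
    and "colon (reduced_ideal F) (reduced_ideal G) =
      (reduce_poly ` (colon (ideal_gen F) (ideal_gen G) \<inter> loc_polys CARD('p))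
        :: ('x, 'p mod_ring) mpoly set)"
    and "finite K\<^sub>c\<^sub>a\<^sub>n"
    and "permissible TYPE('p) prec K\<^sub>c\<^sub>a\<^sub>n"
    and "groebner_basis prec (reduce_poly ` K\<^sub>c\<^sub>a\<^sub>n :: ('x, 'p mod_ring) mpoly set)
      (colon (reduced_ideal F) (colon (reduced_ideal F) (reduced_ideal G)))"
    and "K\<^sub>c\<^sub>a\<^sub>n \<subseteq> colon (ideal_gen F) (colon (ideal_gen F) (ideal_gen G))"
  shows "groebner_basis prec K\<^sub>c\<^sub>a\<^sub>n (colon (ideal_gen F) (colon (ideal_gen F) (ideal_gen G)))"
proof -
  note mo = assms(1)
  define H where "H = colon (ideal_gen F) (colon (ideal_gen F) (ideal_gen G))"
  have H: "ideal.subspace H"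
    unfolding H_def by (intro subspace_colon ideal.subspace_span)
  have KH: "K\<^sub>c\<^sub>a\<^sub>n \<subseteq> H" using assms(8) by (simp add: H_def)
  have lc: "(residue_rat (leading_coeff prec k) :: 'p mod_ring) \<noteq> 0" if "k \<in> K\<^sub>c\<^sub>a\<^sub>n" for k
    using assms(6) that by (simp add: permissible_def)
  have div: "lead_divides prec K\<^sub>c\<^sub>a\<^sub>n (lead_monomial prec h)" if "h \<in> H" "h \<noteq> 0" for h
  proof (rule ccontr)
    assume "\<not> ?thesis"
    from ex_nonzero_reduced[OF mo H KH that this] obtain r where r:
      "r \<in> H" "r \<noteq> 0" "\<forall>t\<in>Poly_Mapping.keys r. \<not> lead_divides prec K\<^sub>c\<^sub>a\<^sub>n t" .
    from ex_scaled_reduction_nonzero[OF r(2), where 'p = 'p] obtain c where c: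
      "Poly_Mapping.single 0 c * r \<in> loc_polys CARD('p)"
      "(reduce_poly (Poly_Mapping.single 0 c * r) :: ('x, 'p mod_ring) mpoly) \<noteq> 0" .
    define s :: "('x, 'p mod_ring) mpoly" where "s = reduce_poly (Poly_Mapping.single 0 c * r)"
    have "Poly_Mapping.single 0 c * r \<in> H"
      using r(1) H ideal.subspace_scale by blast
    then have "s \<in> colon (reduced_ideal F) (colon (reduced_ideal F) (reduced_ideal G))"
      unfolding s_def using reduce_poly_mem_double_colon[OF assms(2,4)] c(1) by (simp add: H_def)
    then have "lead_term prec s \<in> ideal_gen (lead_term prec ` reduce_poly ` K\<^sub>c\<^sub>a\<^sub>n)"
      using assms(7) unfolding groebner_basis_def by (metis ideal.span_base imageI)
    \<comment> \<open>Since \<open>s\<close> is nonzero, its lead term really carries this monomial,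
      and the criterion for monomial ideals applies to it.\<close>
    moreover have "lead_monomial prec s \<in> Poly_Mapping.keys (lead_term prec s)"
      using c(2) leading_coeff_eq_0_iff[OF mo, of s] by (simp add: s_def lead_term_def)
    ultimately have "lead_divides prec (reduce_poly ` K\<^sub>c\<^sub>a\<^sub>n :: ('x, 'p mod_ring) mpoly set)
        (lead_monomial prec s)"
      using lead_divides_if_in_lead_term_ideal[OF mo] by blast
    then obtain k u where k: "k \<in> K\<^sub>c\<^sub>a\<^sub>n"
      "lead_monomial prec s = u + lead_monomial prec (reduce_poly k :: ('x, 'p mod_ring) mpoly)"
      unfolding lead_divides_def by blast
    \<comment> \<open>Permissibility excludes 0, whose leading coefficient 0 has residue 0.\<close>
    moreover have "k \<noteq> 0"
      using lc[OF k(1)] by (auto simp: leading_coeff_def residue_rat_0)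
    ultimately have "lead_divides prec K\<^sub>c\<^sub>a\<^sub>n (lead_monomial prec s)"
      unfolding lead_divides_def using lead_monomial_reduce_poly[OF mo lc] by metis
    moreover have "lead_monomial prec s \<in> Poly_Mapping.keys (Poly_Mapping.single 0 c * r)"
      using lead_monomial_in_keys[OF mo c(2)] keys_reduce_poly unfolding s_def by blast
    then have "lead_monomial prec s \<in> Poly_Mapping.keys r"
      by (auto elim: keys_single_mult)
    ultimately show False using r(3) by blast
  qed
  have "lead_term prec h \<in> ideal_gen (lead_term prec ` K\<^sub>c\<^sub>a\<^sub>n)" if "h \<in> H" for h
  \<comment> \<open>For \<open>h = 0\<close> the leading monomial is arbitrary and
    \<open>div\<close> says nothing, but the lead term is 0.\<close>
  proof (cases "h = 0")
    case True
    then show ?thesis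
      using lead_term_eq_0_iff[OF mo, of h] by (simp add: ideal.span_zero)
  qed (use lead_term_in_ideal_if_lead_divides[OF mo div] that in blast)
  then have "ideal_gen (lead_term prec ` H) \<subseteq> ideal_gen (lead_term prec ` K\<^sub>c\<^sub>a\<^sub>n)"
    by (intro ideal.span_minimal) auto
  moreover have "ideal_gen (lead_term prec ` K\<^sub>c\<^sub>a\<^sub>n) \<subseteq> ideal_gen (lead_term prec ` H)"
    using KH by (intro ideal.span_mono image_mono)
  ultimately show ?thesis
    using assms(5) KH unfolding groebner_basis_def H_def by blast
qed

end
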